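(* Let $r\ge 2$ and $k\ge 0$ be integers, let $a_{-k},\dots,a_k\in\mathbb{Z}_r$, and let $T_{F[-k,k]}:\Omega\to\Omega$, with $\Omega=\mathbb{Z}_r^{\mathbb{Z}}$, be the additive one-dimensional cellular automaton $$(T_{F[-k,k]}x)_n=\sum_{i=-k}^{k}a_i x_{n+i}\ (\mathrm{mod}\ r),\qquad n\in\mathbb{Z}.$$ Let $\mu$ be a probability measure on the product $\sigma$-algebra of $\Omega$ that is invariant under the shift $\sigma$ and under $T_{F[-k,k]}$. Then for every integer $u\ge 0$, $$h_\mu(T_{F[-k,k]}^{u})=u\,h_\mu(T_{F[-k,k]}).$$
   Context: $\mathbb{Z}_r=\{0,1,\dots,r-1\}$ denotes the integers modulo $r$; $\Omega=\mathbb{Z}_r^{\mathbb{Z}}$ is the space of doubly infinite sequences $x=(x_n)_{n\in\mathbb{Z}}$ with the product topology and product $\sigma$-algebra. The shift $\sigma:\Omega\to\Omega$ is $(\sigma x)_n=x_{n+1}$. $T_{F[-k,k]}^{u}$ is the $u$-fold composition of $T_{F[-k,k]}$ with itself ($T_{F[-k,k]}^0$ is the identity). For a measure-preserving transformation $S$ of a probability space with measure $\mu$, $h_\mu(S)$ denotes its measure-theoretic (Kolmogorov–Sinai) entropy. *)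

theory Defs
  imports "HOL-Probability.Probability"
begin

section \<open>Kolmogorov--Sinai entropy\<close>

definition measure_preserving :: "'a measure \<Rightarrow> ('a \<Rightarrow> 'a) \<Rightarrow> bool" where
  "measure_preserving M T \<longleftrightarrow>
     T \<in> M \<rightarrow>\<^sub>M M \<and> (\<forall>A\<in>sets M. emeasure M (T -` A \<inter> space M) = emeasure M A)"

definition finite_measurable_partition :: "'a measure \<Rightarrow> 'a set set \<Rightarrow> bool" where
  "finite_measurable_partition M P \<longleftrightarrow> finite P \<and> P \<subseteq> sets M \<and> partition_on (space M) P"

text \<open>Natural logarithm; the convention \<open>0 * ln 0 = 0\<close> holds automatically.\<close>

definition partition_entropy :: "'a measure \<Rightarrow> 'a set set \<Rightarrow> real" where
  "partition_entropy M P = - (\<Sum>A\<in>P. measure M A * ln (measure M A))"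

text \<open>Empty preimages are dropped because \<^const>\<open>partition_on\<close> excludes empty blocks.\<close>

definition preimage_partition :: "'a measure \<Rightarrow> ('a \<Rightarrow> 'a) \<Rightarrow> 'a set set \<Rightarrow> 'a set set" where
  "preimage_partition M T P = (\<lambda>A. T -` A \<inter> space M) ` P - {{}}"

text \<open>The join of \<open>T\<^sup>-\<^sup>iP\<close> over \<open>0 \<le> i < n\<close>. It is only meaningful for \<open>n > 0\<close>; the value
  at \<open>n = 0\<close> does not affect the limit below.\<close>

definition iterated_join :: "'a measure \<Rightarrow> ('a \<Rightarrow> 'a) \<Rightarrow> 'a set set \<Rightarrow> nat \<Rightarrow> 'a set set" where
  "iterated_join M T P n = common_refinement ((\<lambda>i. preimage_partition M (T ^^ i) P) ` {..<n})"

text \<open>For measure-preserving \<open>T\<close> and a finite measurable partition \<open>P\<close> the limit exists by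
  subadditivity.\<close>

definition entropy_wrt_partition :: "'a measure \<Rightarrow> ('a \<Rightarrow> 'a) \<Rightarrow> 'a set set \<Rightarrow> real" where
  "entropy_wrt_partition M T P = lim (\<lambda>n. partition_entropy M (iterated_join M T P n) / real n)"

definition ks_entropy :: "'a measure \<Rightarrow> ('a \<Rightarrow> 'a) \<Rightarrow> ereal" where
  "ks_entropy M T =
     (SUP P \<in> {P. finite_measurable_partition M P}. ereal (entropy_wrt_partition M T P))"

section \<open>Additive cellular automata\<close>

text \<open>\<open>\<int>\<^sub>r\<close> is represented by \<open>{..<r}\<close>; the underlying set of the measurable space below is
  the set of all functions from \<^typ>\<open>int\<close> to \<open>{..<r}\<close>.\<close>

definition config_space :: "nat \<Rightarrow> (int \<Rightarrow> nat) measure" where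
  "config_space r = (\<Pi>\<^sub>M n\<in>UNIV. count_space {..<r})"

definition shift_map :: "(int \<Rightarrow> nat) \<Rightarrow> int \<Rightarrow> nat" where
  "shift_map x n = x (n + 1)"

definition additive_ca :: "nat \<Rightarrow> nat \<Rightarrow> (int \<Rightarrow> nat) \<Rightarrow> (int \<Rightarrow> nat) \<Rightarrow> int \<Rightarrow> nat" where
  "additive_ca r k a x n = (\<Sum>i=-int k..int k. a i * x (n + i)) mod r"

end

theory Submission
  imports Defs "HOL-Real_Asymp.Real_Asymp"
begin

text \<open>The power rule holds for every measure-preserving \<open>T\<close>. If \<open>Q\<close> is the join of \<open>T\<^sup>-\<^sup>iP\<close> over
  \<open>i < u\<close>, then the \<open>n\<close>-th join of \<open>Q\<close> under \<open>T\<^sup>u\<close> is the \<open>un\<close>-th join of \<open>P\<close> under \<open>T\<close>, so the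
  entropy of \<open>T\<^sup>u\<close> along \<open>Q\<close> is \<open>u\<close> times the entropy of \<open>T\<close> along \<open>P\<close>; and \<open>Q\<close> refines \<open>P\<close>, so
  such \<open>Q\<close> suffice for the supremum. Partitions of a set are compared through the relation of lying
  in a common block, and their Shannon entropy is that of the random variable sending a point to
  its block.\<close>

section \<open>Partitions and the relation of lying in a common block\<close>

text \<open>A block \<open>X\<close> of \<open>Q\<close> is nonempty, so it has a point
  \<open>x\<close>, and \<open>x\<close> lies in some block \<open>Y\<close> of \<open>P\<close>.
  Every other point of \<open>X\<close> shares a block of \<open>P\<close> with \<open>x\<close>,
  and by disjointness that block is \<open>Y\<close>.\<close>

lemma refines_iff_same_block:
  assumes P: "partition_on A P" and Q: "partition_on A Q"
  shows "refines A Q P \<longleftrightarrow>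
    (\<forall>x\<in>A. \<forall>y\<in>A. (\<exists>B\<in>Q. x \<in> B \<and> y \<in> B) \<longrightarrow> (\<exists>B\<in>P. x \<in> B \<and> y \<in> B))"
proof
  assume R: "\<forall>x\<in>A. \<forall>y\<in>A. (\<exists>B\<in>Q. x \<in> B \<and> y \<in> B) \<longrightarrow> (\<exists>B\<in>P. x \<in> B \<and> y \<in> B)"
  have "\<exists>Y\<in>P. X \<subseteq> Y" if X: "X \<in> Q" for X
  proof -
    have "X \<noteq> {}" and XA: "X \<subseteq> A"
      using Q X by (auto simp: partition_on_def)
    then obtain x where x: "x \<in> X" by blast
    then obtain Y where Y: "Y \<in> P" "x \<in> Y"
      using partition_onD1[OF P] XA by blast
    have "y \<in> Y" if y: "y \<in> X" for y
    proof -
      have "x \<in> A" "y \<in> A"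
        using x y XA by auto
      moreover have "\<exists>B\<in>Q. x \<in> B \<and> y \<in> B"
        using X x y by (intro bexI[of _ X]) auto
      ultimately have "\<exists>B\<in>P. x \<in> B \<and> y \<in> B"
        using R by simp
      then obtain Z where Z: "Z \<in> P" "x \<in> Z" "y \<in> Z"
        by (elim bexE conjE)
      have "Z = Y"
        using disjointD[OF partition_onD2[OF P] Z(1) Y(1)] Z(2) Y(2) by auto
      then show ?thesis using Z(3) by simp
    qed
    then show ?thesis using Y(1) by (intro bexI[of _ Y]) auto
  qed
  then show "refines A Q P" using assms by (simp add: refines_def)
next
  assume R: "refines A Q P"
  show "\<forall>x\<in>A. \<forall>y\<in>A. (\<exists>B\<in>Q. x \<in> B \<and> y \<in> B) \<longrightarrow> (\<exists>B\<in>P. x \<in> B \<and> y \<in> B)"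
  proof (intro ballI impI, elim bexE conjE)
    fix x y B assume B: "B \<in> Q" "x \<in> B" "y \<in> B"
    then obtain C where "C \<in> P" "B \<subseteq> C"
      using R unfolding refines_def by metis
    with B show "\<exists>B\<in>P. x \<in> B \<and> y \<in> B" by (intro bexI[of _ C]) auto
  qed
qed

text \<open>Equal relations make each partition refine the other, and refinement is
  antisymmetric.\<close>

lemma partition_eqI:
  assumes "partition_on A P" "partition_on A Q"
    and "\<And>x y. x \<in> A \<Longrightarrow> y \<in> A \<Longrightarrow>
      (\<exists>B\<in>P. x \<in> B \<and> y \<in> B) \<longleftrightarrow> (\<exists>B\<in>Q. x \<in> B \<and> y \<in> B)"
  shows "P = Q"
  by (rule refines_asym[of A]) (simp_all add: refines_iff_same_block assms)

text \<open>Choosing a common block in each member gives a family whose intersection is a block of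
  the common refinement; it is nonempty because it contains \<open>x\<close>.\<close>

lemma same_block_common_refinement:
  "(\<exists>B\<in>common_refinement \<P>. x \<in> B \<and> y \<in> B) \<longleftrightarrow> (\<forall>P\<in>\<P>. \<exists>B\<in>P. x \<in> B \<and> y \<in> B)"
proof
  assume "\<forall>P\<in>\<P>. \<exists>B\<in>P. x \<in> B \<and> y \<in> B"
  then obtain f where f: "\<And>P. P \<in> \<P> \<Longrightarrow> f P \<in> P \<and> x \<in> f P \<and> y \<in> f P"
    by metis
  then have "\<Inter> (f ` \<P>) \<in> common_refinement \<P>"
    by (auto simp: common_refinement Pi_iff)
  then show "\<exists>B\<in>common_refinement \<P>. x \<in> B \<and> y \<in> B"
    using f by (intro bexI[of _ "\<Inter> (f ` \<P>)"]) auto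
qed (auto simp: common_refinement_def PiE_def Pi_iff)

section \<open>Preimages and iterated joins of partitions\<close>

lemma funpow_measure_preserving:
  assumes "measure_preserving M T"
  shows "measure_preserving M (T ^^ n)"
proof (induction n)
  case 0
  then show ?case by (auto simp: measure_preserving_def id_def Int_absorb2 sets.sets_into_space)
next
  case (Suc n)
  have "T \<in> M \<rightarrow>\<^sub>M M" and Tn: "T ^^ n \<in> M \<rightarrow>\<^sub>M M"
    using assms Suc by (auto simp: measure_preserving_def)
  then have meas: "T ^^ Suc n \<in> M \<rightarrow>\<^sub>M M" by simp
  have "emeasure M ((T ^^ Suc n) -` A \<inter> space M) = emeasure M A" if "A \<in> sets M" for A
  proof -
    have "(T ^^ Suc n) -` A \<inter> space M = (T ^^ n) -` (T -` A \<inter> space M) \<inter> space M"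
      using measurable_space[OF Tn] by auto
    moreover have "T -` A \<inter> space M \<in> sets M"
      using \<open>T \<in> M \<rightarrow>\<^sub>M M\<close> that by (rule measurable_sets)
    ultimately show ?thesis
      using assms Suc that unfolding measure_preserving_def by metis
  qed
  with meas show ?case by (simp only: measure_preserving_def) blast
qed

text \<open>Discarding empty preimages is harmless here, as the relevant preimage contains
  \<open>x\<close>.\<close>

lemma same_block_preimage_partition:
  assumes "x \<in> space M" "y \<in> space M"
  shows "(\<exists>B\<in>preimage_partition M T P. x \<in> B \<and> y \<in> B) \<longleftrightarrow> (\<exists>B\<in>P. T x \<in> B \<and> T y \<in> B)"
proof
  assume "\<exists>B\<in>P. T x \<in> B \<and> T y \<in> B"
  then obtain B where "B \<in> P" "T x \<in> B" "T y \<in> B"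
    by (elim bexE conjE)
  then show "\<exists>B\<in>preimage_partition M T P. x \<in> B \<and> y \<in> B"
    using assms by (intro bexI[of _ "T -` B \<inter> space M"]) (auto simp: preimage_partition_def)
qed (auto simp: preimage_partition_def)

lemma finite_measurable_partition_preimage:
  assumes "finite_measurable_partition M P" "T \<in> M \<rightarrow>\<^sub>M M"
  shows "finite_measurable_partition M (preimage_partition M T P)"
  unfolding finite_measurable_partition_def
proof (intro conjI)
  show "finite (preimage_partition M T P)" "preimage_partition M T P \<subseteq> sets M"
    using assms by (auto simp: finite_measurable_partition_def preimage_partition_def)
  have P: "\<Union>P = space M" "disjoint P"
    using assms by (auto simp: finite_measurable_partition_def partition_on_def)
  show "partition_on (space M) (preimage_partition M T P)"
  proof (rule partition_onI)
    show "\<Union> (preimage_partition M T P) = space M"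
    proof
      show "space M \<subseteq> \<Union> (preimage_partition M T P)"
      proof
        fix x assume x: "x \<in> space M"
        then obtain B where "B \<in> P" "T x \<in> B"
          using measurable_space[OF assms(2)] P(1) by blast
        then show "x \<in> \<Union> (preimage_partition M T P)"
          using x by (intro UnionI[of "T -` B \<inter> space M"]) (auto simp: preimage_partition_def)
      qed
    qed (auto simp: preimage_partition_def)
    show "disjnt A B" if AB: "A \<in> preimage_partition M T P" "B \<in> preimage_partition M T P" "A \<noteq> B" for A B
    proof -
      obtain A' B' where *: "A' \<in> P" "B' \<in> P" "A = T -` A' \<inter> space M" "B = T -` B' \<inter> space M"
        using AB by (auto simp: preimage_partition_def)
      with AB have "A' \<inter> B' = {}"
        using P(2) by (metis disjointD)
      with * show ?thesis by (auto simp: disjnt_def)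
    qed
  qed (auto simp: preimage_partition_def)
qed

text \<open>The empty family would have \<open>UNIV\<close>, the intersection of no sets, as its
  only block instead of \<open>space M\<close>; hence \<open>\<P> \<noteq> {}\<close> here and
  \<open>n > 0\<close> for iterated joins.\<close>

lemma finite_measurable_partition_common_refinement:
  assumes "finite \<P>" "\<P> \<noteq> {}" and P: "\<And>P. P \<in> \<P> \<Longrightarrow> finite_measurable_partition M P"
  shows "finite_measurable_partition M (common_refinement \<P>)"
  unfolding finite_measurable_partition_def
proof (intro conjI)
  show "finite (common_refinement \<P>)"
    using assms by (auto simp: common_refinement_def finite_measurable_partition_def intro!: finite_PiE)
  show "common_refinement \<P> \<subseteq> sets M"
    using assms by (auto simp: common_refinement_def finite_measurable_partition_def PiE_def Pi_iff
        intro!: sets.finite_INT)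
  show "partition_on (space M) (common_refinement \<P>)"
    using assms by (intro partition_on_common_refinement) (auto simp: finite_measurable_partition_def)
qed

lemma finite_measurable_partition_iterated_join:
  assumes "finite_measurable_partition M P" "measure_preserving M T" "n > 0"
  shows "finite_measurable_partition M (iterated_join M T P n)"
  unfolding iterated_join_def
  using assms funpow_measure_preserving[OF assms(2)]
  by (intro finite_measurable_partition_common_refinement)
    (auto simp: measure_preserving_def intro!: finite_measurable_partition_preimage)

text \<open>Blocks of the join are classes of points with the same itinerary through
  \<open>P\<close> up to time \<open>n - 1\<close>. Comparisons between joins below all go through
  this criterion.\<close>

lemma same_block_iterated_join:
  assumes "x \<in> space M" "y \<in> space M"
  shows "(\<exists>B\<in>iterated_join M T P n. x \<in> B \<and> y \<in> B) \<longleftrightarrow>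
    (\<forall>i<n. \<exists>B\<in>P. (T ^^ i) x \<in> B \<and> (T ^^ i) y \<in> B)"
  unfolding iterated_join_def
  using assms by (auto simp: same_block_common_refinement same_block_preimage_partition)

text \<open>By division with remainder, the times \<open>i + u * j\<close> with \<open>i < u\<close>
  and \<open>j < n\<close> are exactly the times below \<open>u * n\<close>, so both joins compare
  the same itineraries.\<close>

lemma iterated_join_funpow:
  assumes P: "finite_measurable_partition M P" and T: "measure_preserving M T" and "u > 0" "n > 0"
  shows "iterated_join M (T ^^ u) (iterated_join M T P u) n = iterated_join M T P (u * n)"
proof (rule partition_eqI[of "space M"])
  have Tu: "measure_preserving M (T ^^ u)"
    using T by (rule funpow_measure_preserving)
  show "partition_on (space M) (iterated_join M (T ^^ u) (iterated_join M T P u) n)"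
    "partition_on (space M) (iterated_join M T P (u * n))"
    using finite_measurable_partition_iterated_join[OF finite_measurable_partition_iterated_join[OF P T] Tu]
      finite_measurable_partition_iterated_join[OF P T] assms(3,4)
    by (auto simp: finite_measurable_partition_def)
  fix x y assume xy: "x \<in> space M" "y \<in> space M"
  have sp: "(T ^^ i) z \<in> space M" if "z \<in> space M" for i z
    using funpow_measure_preserving[OF T, of i] that
    by (auto simp: measure_preserving_def dest: measurable_space)
  let ?S = "\<lambda>i. \<exists>B\<in>P. (T ^^ i) x \<in> B \<and> (T ^^ i) y \<in> B"
  have pw: "((T ^^ u) ^^ j) z = (T ^^ (u * j)) z" for j z
    by (simp add: funpow_mult)
  have "(\<exists>B\<in>iterated_join M (T ^^ u) (iterated_join M T P u) n. x \<in> B \<and> y \<in> B)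
      \<longleftrightarrow> (\<forall>j<n. \<forall>i<u. ?S (i + u * j))"
    by (simp add: same_block_iterated_join xy pw sp funpow_add)
  also have "\<dots> \<longleftrightarrow> (\<forall>i<u * n. ?S i)"
  proof (intro iffI allI impI)
    fix i assume *: "\<forall>j<n. \<forall>i<u. ?S (i + u * j)" "i < u * n"
    then have "i div u < n" "i mod u < u" "i = i mod u + u * (i div u)"
      using \<open>u > 0\<close> by (auto simp: less_mult_imp_div_less mult.commute)
    with * show "?S i" by metis
  next
    fix i j assume *: "\<forall>i<u * n. ?S i" "j < n" "i < u"
    have "i + u * j < u * Suc j" using * by simp
    also have "\<dots> \<le> u * n" using * by (intro mult_left_mono) auto
    finally show "?S (i + u * j)" using * by blast
  qed
  finally show "(\<exists>B\<in>iterated_join M (T ^^ u) (iterated_join M T P u) n. x \<in> B \<and> y \<in> B)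
      \<longleftrightarrow> (\<exists>B\<in>iterated_join M T P (u * n). x \<in> B \<and> y \<in> B)"
    by (simp add: same_block_iterated_join xy)
qed

section \<open>The block map as a random variable\<close>

text \<open>The quotient map of the partition, which makes the entropy theory of simple functions
  available. The description is proper only at points covered by disjoint blocks.\<close>

definition block_of :: "'a set set \<Rightarrow> 'a \<Rightarrow> 'a set" where
  "block_of P x = (THE A. A \<in> P \<and> x \<in> A)"

lemma block_of_eq_iff:
  assumes "partition_on A P" "x \<in> A"
  shows "block_of P x = B \<longleftrightarrow> B \<in> P \<and> x \<in> B"
proof -
  obtain C where C: "C \<in> P" "x \<in> C"
    using assms partition_onD1 by blast
  have uniq: "D = C" if "D \<in> P" "x \<in> D" for D
    using disjointD[OF partition_onD2[OF assms(1)] that(1) C(1)] that(2) C(2) by auto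
  have "block_of P x = C"
    unfolding block_of_def
  proof (rule the_equality)
    show "D = C" if "D \<in> P \<and> x \<in> D" for D
      using that by (intro uniq) simp_all
  qed (use C in simp)
  then show ?thesis using C uniq by metis
qed

lemma same_block_iff_block_of_eq:
  assumes "partition_on A P" "x \<in> A" "y \<in> A"
  shows "(\<exists>B\<in>P. x \<in> B \<and> y \<in> B) \<longleftrightarrow> block_of P x = block_of P y"
proof -
  have "(\<exists>B\<in>P. x \<in> B \<and> y \<in> B) \<longleftrightarrow> (\<exists>B. block_of P x = B \<and> block_of P y = B)"
    unfolding block_of_eq_iff[OF assms(1,2)] block_of_eq_iff[OF assms(1,3)] by auto
  then show ?thesis by auto
qed

lemma block_of_image:
  assumes "partition_on A P"
  shows "block_of P ` A = P"
proof -
  have "B \<in> block_of P ` A" if "B \<in> P" for B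
  proof -
    have "B \<noteq> {}" "B \<subseteq> A" using assms that by (auto simp: partition_on_def)
    then obtain x where "x \<in> B" "x \<in> A" by auto
    then show ?thesis using that block_of_eq_iff[OF assms, of x B] by auto
  qed
  moreover have "block_of P x \<in> P" if "x \<in> A" for x
    using block_of_eq_iff[OF assms that] by blast
  ultimately show ?thesis by blast
qed

lemma block_of_vimage:
  assumes "partition_on A P" "B \<in> P"
  shows "block_of P -` {B} \<inter> A = B"
  using assms block_of_eq_iff[OF assms(1)] by (auto simp: partition_on_def)

lemma simple_function_block_of:
  assumes "finite_measurable_partition M P"
  shows "simple_function M (block_of P)"
  using assms by (auto simp: simple_function_def finite_measurable_partition_def
      block_of_image block_of_vimage)

section \<open>Shannon entropy of partitions\<close>

context prob_space
begin

text \<open>The block map is a function of \<open>Y\<close>, and applying a function to a random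
  variable does not increase its entropy.\<close>

lemma partition_entropy_le_entropy:
  assumes "finite_measurable_partition M P" and Y: "simple_function M Y"
    and f: "\<And>x. x \<in> space M \<Longrightarrow> f (Y x) = block_of P x"
  shows "partition_entropy M P \<le> entropy (exp 1) (count_space (Y ` space M)) Y"
proof -
  \<comment> \<open>Base \<open>exp 1\<close> yields the natural logarithm, as in
    \<open>partition_entropy\<close>.\<close>
  interpret information_space M "exp 1" by unfold_locales simp
  have P: "partition_on (space M) P"
    using assms by (simp add: finite_measurable_partition_def)
  have image: "(f \<circ> Y) ` space M = P"
    using f block_of_image[OF P] by (simp add: image_comp[symmetric] image_image)
  have "prob B = prob ((f \<circ> Y) -` {B} \<inter> space M)" if "B \<in> P" for B
  proof -
    have "(f \<circ> Y) -` {B} \<inter> space M = block_of P -` {B} \<inter> space M"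
      using f by auto
    then show ?thesis using block_of_vimage[OF P that] by simp
  qed
  then have "simple_distributed M (f \<circ> Y) prob"
    using Y by (intro simple_distributedI simple_function_compose) (simp_all only: image measure_nonneg)
  from entropy_simple_distributed[OF this]
  have "entropy (exp 1) (count_space ((f \<circ> Y) ` space M)) (f \<circ> Y) = partition_entropy M P"
    unfolding image by (simp add: partition_entropy_def log_def)
  then show ?thesis using entropy_data_processing[OF Y, of f] by simp
qed

text \<open>The preimage of a block under \<open>block_of P\<close> is the block itself, so the
  distribution of this variable is given by the measures of the blocks.\<close>

lemma entropy_block_of:
  assumes "finite_measurable_partition M P"
  shows "entropy (exp 1) (count_space (block_of P ` space M)) (block_of P) = partition_entropy M P"
proof -
  interpret information_space M "exp 1" by unfold_locales simp
  have P: "partition_on (space M) P"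
    using assms by (simp add: finite_measurable_partition_def)
  have "simple_distributed M (block_of P) prob"
    using simple_function_block_of[OF assms]
    by (rule simple_distributedI) (auto simp: block_of_image[OF P] block_of_vimage[OF P])
  from entropy_simple_distributed[OF this] show ?thesis
    by (simp add: partition_entropy_def block_of_image[OF P] log_def)
qed

text \<open>For the block variables, H(R) \<le> H(P,Q) = H(P) + H(Q|P) \<le> H(P) + H(Q). The
  condition \<open>sep\<close> says that \<open>R\<close> is coarser than the join of
  \<open>P\<close> and \<open>Q\<close> without forming that join, so it can be checked directly on
  itineraries.\<close>

lemma partition_entropy_subadditive:
  assumes P: "finite_measurable_partition M P" and Q: "finite_measurable_partition M Q"
    and R: "finite_measurable_partition M R"
    and sep: "\<And>x y. x \<in> space M \<Longrightarrow> y \<in> space M \<Longrightarrow> \<exists>B\<in>P. x \<in> B \<and> y \<in> B \<Longrightarrow>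
      \<exists>B\<in>Q. x \<in> B \<and> y \<in> B \<Longrightarrow> \<exists>B\<in>R. x \<in> B \<and> y \<in> B"
  shows "partition_entropy M R \<le> partition_entropy M P + partition_entropy M Q"
proof -
  interpret information_space M "exp 1" by unfold_locales simp
  have part: "partition_on (space M) P" "partition_on (space M) Q" "partition_on (space M) R"
    using P Q R by (simp_all add: finite_measurable_partition_def)
  let ?X = "block_of P" and ?Y = "block_of Q"
  let ?XY = "\<lambda>x. (?X x, ?Y x)"
  let ?H = "\<lambda>Z. entropy (exp 1) (count_space (Z ` space M)) Z"
  note simple = simple_function_block_of[OF P] simple_function_block_of[OF Q]
  \<comment> \<open>\<open>f\<close> reads off the \<open>R\<close>-block from the pair of blocks by
    picking a point with that pair; \<open>sep\<close> makes the result independent of the point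
    picked.\<close>
  define f where "f v = block_of R (inv_into (space M) ?XY v)" for v
  have "f (?XY x) = block_of R x" if x: "x \<in> space M" for x
  proof -
    let ?y = "inv_into (space M) ?XY (?XY x)"
    have y: "?y \<in> space M" "?XY ?y = ?XY x"
      using inv_into_into[of "?XY x" ?XY "space M"] f_inv_into_f[of "?XY x" ?XY "space M"] x by simp_all
    then show ?thesis
      using sep[OF y(1) x] part[THEN same_block_iff_block_of_eq, OF y(1) x]
      by (simp add: f_def)
  qed
  then have "partition_entropy M R \<le> entropy (exp 1) (count_space (?XY ` space M)) ?XY"
    by (rule partition_entropy_le_entropy[OF R simple_function_Pair[OF simple]])
  also have "\<dots> \<le> ?H ?X + ?H ?Y"
    using entropy_chain_rule[OF simple] conditional_entropy_less_eq_entropy[OF simple(2,1)] by simp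
  finally show ?thesis by (simp add: entropy_block_of P Q)
qed

lemma finite_measurable_partition_trivial: "finite_measurable_partition M {space M}"
  using not_empty by (simp add: finite_measurable_partition_def partition_on_space)

lemma partition_entropy_trivial: "partition_entropy M {space M} = 0"
  by (simp add: partition_entropy_def prob_space)

text \<open>Subadditivity applied to \<open>Q\<close> and the trivial partition, whose entropy is
  \<open>0\<close>.\<close>

lemma partition_entropy_mono:
  assumes P: "finite_measurable_partition M P" and Q: "finite_measurable_partition M Q"
    and "refines (space M) Q P"
  shows "partition_entropy M P \<le> partition_entropy M Q"
proof -
  have "partition_entropy M P \<le> partition_entropy M Q + partition_entropy M {space M}"
    using assms by (intro partition_entropy_subadditive finite_measurable_partition_trivial)
      (auto simp: finite_measurable_partition_def refines_iff_same_block)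
  then show ?thesis by (simp add: partition_entropy_trivial)
qed

lemma partition_entropy_nonneg: "0 \<le> partition_entropy M P"
proof -
  have "prob A * ln (prob A) \<le> 0" for A
    by (cases "prob A = 0") (auto intro!: mult_nonneg_nonpos simp: zero_less_measure_iff)
  then show ?thesis
    by (simp add: partition_entropy_def sum_nonpos)
qed

text \<open>A block and its preimage have equal measure, and the empty preimages that are dropped
  contribute \<open>0\<close>.\<close>

lemma partition_entropy_preimage:
  assumes "finite_measurable_partition M P" and T: "measure_preserving M T"
  shows "partition_entropy M (preimage_partition M T P) = partition_entropy M P"
proof -
  define g where "g A = measure M A * ln (measure M A)" for A
  define F where "F A = T -` A \<inter> space M" for A
  have P: "finite P" "P \<subseteq> sets M" "disjoint P"
    using assms(1) by (auto simp: finite_measurable_partition_def partition_on_def)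
  have "sum g (F ` P - {{}}) = sum g (F ` P)"
    using P by (intro sum.mono_neutral_left) (auto simp: g_def)
  also have "\<dots> = sum (g \<circ> F) P"
  \<comment> \<open>\<open>F\<close> need not be injective on \<open>P\<close>, but distinct blocks
    are disjoint, so a preimage they share is empty and its term is \<open>0\<close>.\<close>
  proof (rule sum.reindex_nontrivial[OF P(1)])
    fix A B assume "A \<in> P" "B \<in> P" "A \<noteq> B" "F A = F B"
    then have "A \<inter> B = {}" using P(3) by (metis disjointD)
    with \<open>F A = F B\<close> have "F A = {}" unfolding F_def by blast
    then show "g (F A) = 0" by (simp add: g_def)
  qed
  also have "\<dots> = sum g P"
  proof (rule sum.cong)
    fix A assume "A \<in> P"
    then have "measure M (F A) = measure M A"
      using P(2) T by (auto simp: F_def measure_def measure_preserving_def)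
    then show "(g \<circ> F) A = g A" by (simp add: g_def)
  qed simp
  finally show ?thesis
    by (simp add: partition_entropy_def preimage_partition_def g_def F_def[abs_def])
qed

text \<open>An itinerary of length \<open>m + n\<close> is one of length \<open>m\<close> followed
  by the itinerary of length \<open>n\<close> of the point moved by \<open>T ^^ m\<close>. The
  second part corresponds to a preimage partition, which has the same entropy as the join
  itself.\<close>

lemma partition_entropy_iterated_join_add:
  assumes P: "finite_measurable_partition M P" and T: "measure_preserving M T"
    and "m > 0" "n > 0"
  shows "partition_entropy M (iterated_join M T P (m + n)) \<le>
    partition_entropy M (iterated_join M T P m) + partition_entropy M (iterated_join M T P n)"
proof -
  let ?J = "iterated_join M T P"
  have Tm: "measure_preserving M (T ^^ m)"
    using T by (rule funpow_measure_preserving)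
  have J: "finite_measurable_partition M (?J i)" if "i > 0" for i
    using finite_measurable_partition_iterated_join[OF P T that] .
  have meas: "T ^^ m \<in> M \<rightarrow>\<^sub>M M"
    using Tm by (simp add: measure_preserving_def)
  have "partition_entropy M (?J (m + n)) \<le>
      partition_entropy M (?J m) + partition_entropy M (preimage_partition M (T ^^ m) (?J n))"
  proof (rule partition_entropy_subadditive)
    fix x y assume xy: "x \<in> space M" "y \<in> space M"
      and 1: "\<exists>B\<in>?J m. x \<in> B \<and> y \<in> B"
      and 2: "\<exists>B\<in>preimage_partition M (T ^^ m) (?J n). x \<in> B \<and> y \<in> B"
    let ?S = "\<lambda>i. \<exists>B\<in>P. (T ^^ i) x \<in> B \<and> (T ^^ i) y \<in> B"
    have "\<forall>i<m. ?S i"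
      using 1 by (simp add: same_block_iterated_join xy)
    moreover have "\<forall>i<n. ?S (i + m)"
      using 2 xy measurable_space[OF meas]
      by (simp add: same_block_preimage_partition same_block_iterated_join funpow_add)
    ultimately have "?S i" if "i < m + n" for i
    proof (cases "i < m")
      case False
      then have "i = (i - m) + m" "i - m < n" using that by auto
      with \<open>\<forall>i<n. ?S (i + m)\<close> show ?thesis by metis
    qed auto
    then show "\<exists>B\<in>?J (m + n). x \<in> B \<and> y \<in> B"
      by (simp add: same_block_iterated_join xy)
  qed (use J assms meas finite_measurable_partition_preimage in auto)
  then show ?thesis
    using partition_entropy_preimage[OF J Tm] \<open>n > 0\<close> by simp
qed

end

text \<open>Fekete's lemma.\<close>

lemma subadditive_imp_convergent:
  fixes h :: "nat \<Rightarrow> real"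
  assumes sub: "\<And>m n. m > 0 \<Longrightarrow> n > 0 \<Longrightarrow> h (m + n) \<le> h m + h n"
    and nonneg: "\<And>n. n > 0 \<Longrightarrow> 0 \<le> h n"
  shows "convergent (\<lambda>n. h n / real n)"
proof -
  \<comment> \<open>Nothing is known about \<open>h 0\<close>; the value \<open>0\<close> there
    makes \<open>b\<close> subadditive for all arguments. The quotients do not change, since
    division by \<open>0\<close> gives \<open>0\<close>.\<close>
  define b where "b n = (if n = 0 then 0 else h n)" for n
  have b_sub: "b (m + n) \<le> b m + b n" for m n
    using sub by (auto simp: b_def)
  have b_nonneg: "0 \<le> b n" for n using nonneg by (auto simp: b_def)
  \<comment> \<open>The limit is the infimum of the quotients, so only the upper estimate needs an
    argument.\<close>
  define L where "L = (INF n\<in>{0<..}. b n / real n)"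
  have bdd: "bdd_below ((\<lambda>n. b n / real n) ` {0<..})"
    using b_nonneg by (intro bdd_belowI2[of _ 0]) auto
  have b_mult: "b (q * N) \<le> real q * b N" for q N
  proof (induction q)
    case (Suc q)
    then show ?case using b_sub[of N "q * N"] by (simp add: algebra_simps)
  qed (simp add: b_def)
  have "(\<lambda>n. b n / real n) \<longlonglongrightarrow> L"
  proof (rule tendstoI)
    fix e :: real assume "e > 0"
    have "\<exists>N\<in>{0<..}. b N / real N < L + e / 2"
      using bdd \<open>e > 0\<close> unfolding L_def by (subst cINF_less_iff[symmetric]) auto
    then obtain N where N: "N > 0" "b N / real N < L + e / 2" by auto
    \<comment> \<open>A bound for \<open>b\<close> at every remainder modulo \<open>N\<close>,
      independent of \<open>n\<close>.\<close>
    define C where "C = Max (b ` {..<N})"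
    have "\<forall>\<^sub>F n in sequentially. C / real n < e / 2"
      using \<open>e > 0\<close> by real_asymp
    then show "\<forall>\<^sub>F n in sequentially. dist (b n / real n) L < e"
      using eventually_gt_at_top[of 0]
    proof eventually_elim
      case (elim n)
      \<comment> \<open>Split \<open>n\<close> into a multiple of \<open>N\<close> and a remainder;
        the multiple costs at most \<open>n div N\<close> times \<open>b N\<close>.\<close>
      have "b n \<le> b (n div N * N) + b (n mod N)"
        using b_sub[of "n div N * N" "n mod N"] by simp
      moreover have "b (n mod N) \<le> C"
        unfolding C_def using N by (intro Max_ge) auto
      moreover have "real (n div N) * b N \<le> real n / real N * b N"
        using b_nonneg by (intro mult_right_mono of_nat_div_le_of_nat)
      ultimately have "b n \<le> real n / real N * b N + C"
        using b_mult[of "n div N" N] by linarith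
      then have "b n / real n \<le> b N / real N + C / real n"
        using elim(2) N by (simp add: field_simps)
      moreover have "L \<le> b n / real n"
        unfolding L_def using bdd elim(2) by (intro cINF_lower) auto
      moreover have "C / real n < e / 2" by (rule elim)
      ultimately show ?case unfolding dist_real_def using N(2) by linarith
    qed
  qed
  moreover have "(\<lambda>n. b n / real n) = (\<lambda>n. h n / real n)"
    by (auto simp: b_def)
  ultimately show ?thesis by (auto simp: convergent_def)
qed

section \<open>Entropy along a partition and the power rule\<close>

context prob_space
begin

text \<open>Fekete's lemma applies to the entropies of the joins, so the \<open>lim\<close> in the
  definition is a genuine limit.\<close>

lemma entropy_wrt_partition_tendsto:
  assumes "finite_measurable_partition M P" "measure_preserving M T"
  shows "(\<lambda>n. partition_entropy M (iterated_join M T P n) / real n)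
    \<longlonglongrightarrow> entropy_wrt_partition M T P"
  unfolding entropy_wrt_partition_def convergent_LIMSEQ_iff[symmetric]
  using assms by (intro subadditive_imp_convergent partition_entropy_iterated_join_add
      partition_entropy_nonneg finite_measurable_partition_iterated_join)

lemma entropy_wrt_partition_mono:
  assumes P: "finite_measurable_partition M P" and Q: "finite_measurable_partition M Q"
    and T: "measure_preserving M T" and ref: "refines (space M) Q P"
  shows "entropy_wrt_partition M T P \<le> entropy_wrt_partition M T Q"
proof (rule tendsto_le[OF _ entropy_wrt_partition_tendsto[OF Q T] entropy_wrt_partition_tendsto[OF P T]])
  have part: "partition_on (space M) P" "partition_on (space M) Q"
    using P Q by (simp_all add: finite_measurable_partition_def)
  have sp: "(T ^^ i) z \<in> space M" if "z \<in> space M" for i z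
    using funpow_measure_preserving[OF T, of i] that
    by (auto simp: measure_preserving_def dest: measurable_space)
  \<comment> \<open>The itinerary through the finer partition determines the one through the
    coarser.\<close>
  have "refines (space M) (iterated_join M T Q n) (iterated_join M T P n)" if "n > 0" for n
    using ref sp finite_measurable_partition_iterated_join[OF P T that]
      finite_measurable_partition_iterated_join[OF Q T that]
    by (simp add: refines_iff_same_block part finite_measurable_partition_def same_block_iterated_join)
  then show "\<forall>\<^sub>F n in sequentially. partition_entropy M (iterated_join M T P n) / real n
      \<le> partition_entropy M (iterated_join M T Q n) / real n"
    by (intro eventually_mono[OF eventually_gt_at_top[of 0]] divide_right_mono partition_entropy_mono
        finite_measurable_partition_iterated_join P Q T) auto
qed simp

text \<open>The quotient at \<open>n\<close> is \<open>u\<close> times the quotient of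
  \<open>T\<close> along \<open>P\<close> at \<open>u * n\<close>, and the latter runs through a
  subsequence of a convergent sequence.\<close>

lemma entropy_wrt_partition_funpow:
  assumes P: "finite_measurable_partition M P" and T: "measure_preserving M T" and "u > 0"
  shows "entropy_wrt_partition M (T ^^ u) (iterated_join M T P u) = real u * entropy_wrt_partition M T P"
proof (rule LIMSEQ_unique)
  let ?H = "\<lambda>n. partition_entropy M (iterated_join M T P n)"
  show "(\<lambda>n. partition_entropy M (iterated_join M (T ^^ u) (iterated_join M T P u) n) / real n)
      \<longlonglongrightarrow> entropy_wrt_partition M (T ^^ u) (iterated_join M T P u)"
    using assms by (intro entropy_wrt_partition_tendsto funpow_measure_preserving
        finite_measurable_partition_iterated_join)
  have "(\<lambda>n. ?H (u * n) / real (u * n)) \<longlonglongrightarrow> entropy_wrt_partition M T P"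
    using LIMSEQ_subseq_LIMSEQ[OF entropy_wrt_partition_tendsto[OF P T], of "\<lambda>n. u * n"] \<open>u > 0\<close>
    by (simp add: strict_mono_def o_def)
  then have "(\<lambda>n. real u * (?H (u * n) / real (u * n))) \<longlonglongrightarrow> real u * entropy_wrt_partition M T P"
    by (rule tendsto_mult_left)
  then show "(\<lambda>n. partition_entropy M (iterated_join M (T ^^ u) (iterated_join M T P u) n) / real n)
      \<longlonglongrightarrow> real u * entropy_wrt_partition M T P"
  proof (rule Lim_transform_eventually)
    show "\<forall>\<^sub>F n in sequentially. real u * (?H (u * n) / real (u * n)) =
        partition_entropy M (iterated_join M (T ^^ u) (iterated_join M T P u) n) / real n"
      using eventually_gt_at_top[of 0]
      by eventually_elim (use \<open>u > 0\<close> in \<open>simp add: iterated_join_funpow[OF P T]\<close>)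
  qed
qed

text \<open>Every join with \<open>n > 0\<close> equals \<open>P\<close>, so a constant is divided
  by \<open>n\<close>. This serves the case \<open>u = 0\<close> of the power rule.\<close>

lemma entropy_wrt_partition_id:
  assumes P: "finite_measurable_partition M P"
  shows "entropy_wrt_partition M id P = 0"
proof (rule LIMSEQ_unique)
  have id: "measure_preserving M id"
    using funpow_measure_preserving[of M id 0] by (simp add: measure_preserving_def id_def Int_absorb2 sets.sets_into_space)
  show "(\<lambda>n. partition_entropy M (iterated_join M id P n) / real n) \<longlonglongrightarrow> entropy_wrt_partition M id P"
    using P id by (rule entropy_wrt_partition_tendsto)
  have join: "iterated_join M id P n = P" if "n > 0" for n
    using finite_measurable_partition_iterated_join[OF P id that] P that
    by (intro partition_eqI[of "space M"])
      (auto simp: finite_measurable_partition_def same_block_iterated_join)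
  have "(\<lambda>n. partition_entropy M P / real n) \<longlonglongrightarrow> 0"
    by real_asymp
  then show "(\<lambda>n. partition_entropy M (iterated_join M id P n) / real n) \<longlonglongrightarrow> 0"
  proof (rule Lim_transform_eventually)
    show "\<forall>\<^sub>F n in sequentially. partition_entropy M P / real n =
        partition_entropy M (iterated_join M id P n) / real n"
      using eventually_gt_at_top[of 0] by eventually_elim (simp add: join)
  qed
qed

theorem ks_entropy_funpow:
  assumes T: "measure_preserving M T"
  shows "ks_entropy M (T ^^ u) = ereal (real u) * ks_entropy M T"
proof -
  let ?\<P> = "{P. finite_measurable_partition M P}"
  have ne: "?\<P> \<noteq> {}"
    using finite_measurable_partition_trivial by blast
  show ?thesis
  proof (cases "u = 0")
    case True
    have "ks_entropy M id = (SUP P\<in>?\<P>. 0)"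
      unfolding ks_entropy_def by (intro SUP_cong) (auto simp: entropy_wrt_partition_id)
    \<comment> \<open>In \<open>ereal\<close>, \<open>0 * \<infinity> = 0\<close>, so the right-hand
      side vanishes even for infinite entropy.\<close>
    with True ne show ?thesis by (simp add: zero_ereal_def[symmetric])
  next
    case False
    then have u: "u > 0" by simp
    let ?h = "\<lambda>P. ereal (entropy_wrt_partition M T P)"
    have Tu: "measure_preserving M (T ^^ u)"
      using T by (rule funpow_measure_preserving)
    have join: "finite_measurable_partition M (iterated_join M T P u)" if "P \<in> ?\<P>" for P
      using finite_measurable_partition_iterated_join[OF _ T u] that by simp
    have eq: "ereal (entropy_wrt_partition M (T ^^ u) (iterated_join M T P u)) = ereal (real u) * ?h P"
      if "P \<in> ?\<P>" for P
      using entropy_wrt_partition_funpow[OF _ T u] that by simp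
    have "ks_entropy M (T ^^ u) = (SUP P\<in>?\<P>. ereal (real u) * ?h P)"
      unfolding ks_entropy_def
    proof (rule antisym; rule SUP_least)
      fix P assume P: "P \<in> ?\<P>"
      have "refines (space M) (iterated_join M T P u) P"
      proof (subst refines_iff_same_block)
        show "\<forall>x\<in>space M. \<forall>y\<in>space M. (\<exists>B\<in>iterated_join M T P u. x \<in> B \<and> y \<in> B) \<longrightarrow>
            (\<exists>B\<in>P. x \<in> B \<and> y \<in> B)"
        proof (intro ballI impI)
          fix x y
          assume "x \<in> space M" "y \<in> space M" "\<exists>B\<in>iterated_join M T P u. x \<in> B \<and> y \<in> B"
          then have "\<forall>i<u. \<exists>B\<in>P. (T ^^ i) x \<in> B \<and> (T ^^ i) y \<in> B"
            by (simp only: same_block_iterated_join)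
          \<comment> \<open>Time \<open>0\<close> is among the times compared because
            \<open>u > 0\<close>, and there the itinerary is the block of \<open>P\<close>
            itself.\<close>
          from this[rule_format, OF u] show "\<exists>B\<in>P. x \<in> B \<and> y \<in> B" by simp
        qed
      qed (use P join[OF P] in \<open>simp_all add: finite_measurable_partition_def\<close>)
      then have "entropy_wrt_partition M (T ^^ u) P
          \<le> entropy_wrt_partition M (T ^^ u) (iterated_join M T P u)"
        using P join[OF P] Tu by (intro entropy_wrt_partition_mono) auto
      then show "ereal (entropy_wrt_partition M (T ^^ u) P) \<le> (SUP P\<in>?\<P>. ereal (real u) * ?h P)"
        using eq[OF P] P by (intro SUP_upper2[of P]) auto
    next
      fix P assume P: "P \<in> ?\<P>"
      then show "ereal (real u) * ?h P \<le> (SUP P\<in>?\<P>. ereal (entropy_wrt_partition M (T ^^ u) P))"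
        using eq[OF P] join[OF P] by (intro SUP_upper2[of "iterated_join M T P u"]) auto
    qed
    also have "\<dots> = ereal (real u) * ks_entropy M T"
      unfolding ks_entropy_def
      \<comment> \<open>A nonnegative real factor may be moved out of a supremum over a nonempty
        set, also when the supremum is infinite.\<close>
      using ne by (intro Sup_ereal_mult_left'[symmetric]) auto
    finally show ?thesis .
  qed
qed

end

section \<open>The power rule for additive cellular automata\<close>

theorem theorem3p3:
  fixes r k u :: nat and a :: "int \<Rightarrow> nat" and M :: "(int \<Rightarrow> nat) measure"
  assumes "r \<ge> 2"
    and "\<And>i. i \<in> {-int k..int k} \<Longrightarrow> a i < r"
    and "prob_space M"
    and "sets M = sets (config_space r)"
    and "measure_preserving M shift_map"
    and "measure_preserving M (additive_ca r k a)"
  shows "ks_entropy M (additive_ca r k a ^^ u) = ereal (real u) * ks_entropy M (additive_ca r k a)"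
  using prob_space.ks_entropy_funpow[OF assms(3,6)] .

end
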